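(* Let $j$ be a positive integer, $\sigma_j=p_1+p_2+\dots+p_j$ and $N_j=p_1p_2\cdots p_j$, where $p_i$ denotes the $i$-th prime. Then $h(\sigma_j)=N_j$.
   Context: For an integer $n\ge0$, $h(n)$ is the maximum of all squarefree positive integers $M$ such that the sum $\ell(M)$ of the prime factors of $M$ satisfies $\ell(M)\le n$ (with $\ell(1)=0$); i.e. $h(n)$ is the greatest product of a family of distinct primes whose sum does not exceed $n$. *)

theory Defs
  imports "HOL-Computational_Algebra.Computational_Algebra" "HOL-Library.Infinite_Set"
begin

(* Primes are numbered from 1, so nth_prime 1 = 2.  The truncated subtraction makes
   nth_prime 0 = 2 as well; index 0 is never meant to be used. *)
definition nth_prime :: "nat \<Rightarrow> nat" where
  "nth_prime i = enumerate {p. prime p} (i - 1)"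

(* Multiplicities are ignored; only squarefree arguments are relevant below. *)
definition ell :: "nat \<Rightarrow> nat" where
  "ell M = \<Sum>(prime_factors M)"

definition h :: "nat \<Rightarrow> nat" where
  "h n = Max {M. squarefree M \<and> ell M \<le> n}"

(* The set in the definition of h is finite and contains 1, so that Max is a genuine maximum. *)
lemma finite_h_set: "finite {M. squarefree M \<and> ell M \<le> n}"
proof (rule finite_subset)
  show "{M. squarefree M \<and> ell M \<le> n} \<subseteq> (\<lambda>A. \<Prod>A) ` Pow {..n}"
  proof
    fix M assume "M \<in> {M. squarefree M \<and> ell M \<le> n}"
    then have sf: "squarefree M" and le: "\<Sum>(prime_factors M) \<le> n"
      by (auto simp: ell_def)
    have "M \<noteq> 0" using sf by (auto intro: ccontr)
    have "p \<le> n" if "p \<in> prime_factors M" for p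
      using member_le_sum[of p "prime_factors M" "\<lambda>x. x"] that le by simp
    moreover have "M = \<Prod>(prime_factors M)"
    proof -
      have "M = (\<Prod>p\<in>prime_factors M. p ^ multiplicity p M)"
        using prod_prime_factors[OF \<open>M \<noteq> 0\<close>] by simp
      also have "\<dots> = \<Prod>(prime_factors M)"
        using sf \<open>M \<noteq> 0\<close>
        by (intro prod.cong) (auto simp: squarefree_factorial_semiring')
      finally show ?thesis .
    qed
    ultimately show "M \<in> (\<lambda>A. \<Prod>A) ` Pow {..n}" by (auto intro!: image_eqI)
  qed
qed simp

lemma one_in_h_set: "1 \<in> {M. squarefree M \<and> ell M \<le> n}"
  by (simp add: ell_def)

end

theory Submission
  imports Defs
begin

text \<open>
  Let \<open>A\<close> be the set of the first \<open>j\<close> primes, \<open>S\<close> any set of primes with \<open>\<Sum>S \<le> \<Sum>A\<close>, and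
  \<open>t = max 4 p\<^sub>j\<close>. Since \<open>ln x / x\<close> is decreasing for \<open>x \<ge> e\<close> and \<open>ln 2 / 2 = ln 4 / 4\<close>, the slope
  \<open>c = ln t / t\<close> satisfies \<open>ln p \<ge> c p\<close> for \<open>p \<in> A\<close> and \<open>ln p \<le> c p\<close> for primes \<open>p \<notin> A\<close>, provided
  \<open>p\<^sub>j \<ge> 3\<close>. Hence exchanging \<open>A - S\<close> for \<open>S - A\<close>, which does not increase the sum, does not
  increase the product either. If \<open>p\<^sub>j = 2\<close>, then \<open>S \<subseteq> {2}\<close>.
\<close>

text \<open>The common part \<open>S \<inter> A\<close> cancels from the sums and from the
  logarithms of the products. What remains is a chain through the line of slope \<open>c\<close>:
  logarithms over \<open>S - A\<close> lie below it, those over \<open>A - S\<close> above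
  it.\<close>

lemma prod_le_prod_if_sum_le:
  fixes S A :: "nat set" and c :: real
  assumes fin: "finite S" "finite A" and pos: "0 \<notin> S" "0 \<notin> A" and "c \<ge> 0"
    and S: "\<And>x. x \<in> S - A \<Longrightarrow> ln (real x) \<le> c * real x"
    and A: "\<And>x. x \<in> A - S \<Longrightarrow> c * real x \<le> ln (real x)"
    and sum: "\<Sum>S \<le> \<Sum>A"
  shows "\<Prod>S \<le> \<Prod>A"
proof -
  have ln_prod: "ln (real (\<Prod>X)) = (\<Sum>x\<in>X. ln (real x))" if "finite X" "0 \<notin> X" for X :: "nat set"
  proof -
    have "\<And>x. x \<in> X \<Longrightarrow> real x > 0"
      using that by (metis gr0I of_nat_0_less_iff)
    then show ?thesis using that by (simp add: ln_prod)
  qed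
  have prod_pos: "\<Prod>X > 0" if "finite X" "0 \<notin> X" for X :: "nat set"
    using that by (metis gr0I prod_zero_iff)
  have split: "sum f S = sum f (S \<inter> A) + sum f (S - A)" "sum f A = sum f (S \<inter> A) + sum f (A - S)"
    for f :: "nat \<Rightarrow> real"
    using sum.Int_Diff[OF fin(1), of f A] sum.Int_Diff[OF fin(2), of f S]
    by (auto simp: Int_commute)
  have "(\<Sum>x\<in>S. real x) \<le> (\<Sum>x\<in>A. real x)"
    using sum unfolding of_nat_sum[symmetric] of_nat_le_iff .
  then have "(\<Sum>x\<in>S-A. real x) \<le> (\<Sum>x\<in>A-S. real x)"
    using split[of real] by simp
  then have "c * (\<Sum>x\<in>S-A. real x) \<le> c * (\<Sum>x\<in>A-S. real x)"
    using \<open>c \<ge> 0\<close> by (rule mult_left_mono)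
  moreover have "(\<Sum>x\<in>S-A. ln (real x)) \<le> c * (\<Sum>x\<in>S-A. real x)"
    unfolding sum_distrib_left by (rule sum_mono) (rule S)
  moreover have "c * (\<Sum>x\<in>A-S. real x) \<le> (\<Sum>x\<in>A-S. ln (real x))"
    unfolding sum_distrib_left by (rule sum_mono) (rule A)
  ultimately have "(\<Sum>x\<in>S-A. ln (real x)) \<le> (\<Sum>x\<in>A-S. ln (real x))"
    by (meson order_trans)
  then have "(\<Sum>x\<in>S. ln (real x)) \<le> (\<Sum>x\<in>A. ln (real x))"
    unfolding split[of "\<lambda>x. ln (real x)"] by (rule add_left_mono)
  then have "ln (real (\<Prod>S)) \<le> ln (real (\<Prod>A))"
    by (simp only: ln_prod fin pos not_False_eq_True)
  then show ?thesis
    using prod_pos[OF fin(1) pos(1)] prod_pos[OF fin(2) pos(2)]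
    by (metis ln_le_cancel_iff of_nat_0_less_iff of_nat_le_iff)
qed

lemma ln_le_slope:
  fixes t x :: real
  assumes "4 \<le> t" "t \<le> x"
  shows "ln x \<le> ln t / t * x"
proof -
  have "ln x / x \<le> ln t / t"
    using assms exp_le by (intro ln_x_over_x_mono) auto
  then show ?thesis using assms by (simp add: field_simps)
qed

text \<open>Integrality of \<open>n\<close> matters: among the integers from 2 on, only 2 lies below
  e, where \<open>ln x / x\<close> is not yet decreasing.\<close>

lemma slope_le_ln:
  fixes t :: real and n :: nat
  assumes "4 \<le> t" "2 \<le> n" "real n \<le> t"
  shows "ln t / t * real n \<le> ln (real n)"
proof -
  have "ln t / t \<le> ln (real n) / real n"
  proof (cases "n = 2")
    case True
    \<comment> \<open>Thus \<open>ln 2 / 2 = ln 4 / 4\<close>, and 4 stands in for 2 on the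
      decreasing branch; this is where \<open>4 \<le> t\<close> is used.\<close>
    have "ln (4::real) = 2 * ln 2"
      using ln_realpow[of "2::real" 2] by simp
    moreover have "ln t / t \<le> ln 4 / 4"
      using assms exp_le by (intro ln_x_over_x_mono) auto
    ultimately show ?thesis using True by simp
  next
    case False
    then show ?thesis
      using assms exp_le by (intro ln_x_over_x_mono) auto
  qed
  then show ?thesis using assms by (simp add: field_simps)
qed

lemma prod_primes_le:
  fixes S :: "nat set" and n :: nat
  defines "A \<equiv> {p. prime p \<and> p \<le> n}"
  assumes "finite S" and prime: "\<And>p. p \<in> S \<Longrightarrow> prime p" and sum: "\<Sum>S \<le> \<Sum>A"
  shows "\<Prod>S \<le> \<Prod>A"
proof -
  have finA: "finite A" unfolding A_def by simp
  have pos: "0 \<notin> S" "0 \<notin> A" using prime[of 0] unfolding A_def by auto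
  show ?thesis
  proof (cases "n \<le> 2")
    \<comment> \<open>For \<open>n = 2\<close> no slope separates \<open>A\<close> from the other
      primes, since \<open>ln 3 / 3 > ln 2 / 2\<close>. Here sums this small force
      \<open>S \<subseteq> A\<close> directly.\<close>
    case True
    have "A \<subseteq> {2}"
      using True by (auto simp: A_def dest: prime_ge_2_nat)
    then have "A = {} \<or> A = {2}" by blast
    moreover have "p \<le> \<Sum>A" if "p \<in> S" for p
      using member_le_sum[of p S "\<lambda>x. x"] that \<open>finite S\<close> sum by simp
    ultimately have "S \<subseteq> A"
      using prime by (fastforce dest: prime_ge_2_nat)
    moreover have "x > 0" if "x \<in> A" for x using that pos by (metis gr0I)
    ultimately show ?thesis
      using finA by (intro dvd_imp_le prod_dvd_prod_subset prod_pos) auto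
  next
    case False
    \<comment> \<open>For \<open>n = 3\<close> the choice \<open>t = 3\<close> would fail at 2,
      which lies in \<open>A\<close>; hence the lower bound 4.\<close>
    define t where "t = real (max 4 n)"
    have t: "4 \<le> t" by (simp add: t_def)
    show ?thesis
    proof (rule prod_le_prod_if_sum_le[where c = "ln t / t"])
      \<comment> \<open>A prime outside \<open>A\<close> exceeds \<open>n \<ge> 3\<close>, so it is
        at least 4 and therefore at least \<open>t\<close>.\<close>
      show "ln (real x) \<le> ln t / t * real x" if "x \<in> S - A" for x
        using that prime[of x] False by (intro ln_le_slope t) (auto simp: A_def t_def)
      show "ln t / t * real x \<le> ln (real x)" if "x \<in> A - S" for x
        using that prime_ge_2_nat[of x] by (intro slope_le_ln t) (auto simp: A_def t_def)
    qed (use t \<open>finite S\<close> finA pos sum in auto)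
  qed
qed

lemma prod_prime_factors_squarefree:
  fixes M :: nat
  assumes "squarefree M"
  shows "\<Prod>(prime_factors M) = M"
proof -
  have "M \<noteq> 0" using assms by (auto intro: ccontr)
  then have "M = (\<Prod>p\<in>prime_factors M. p ^ multiplicity p M)"
    by (simp add: prod_prime_factors)
  also have "\<dots> = \<Prod>(prime_factors M)"
    using assms \<open>M \<noteq> 0\<close> by (intro prod.cong) (auto simp: squarefree_factorial_semiring')
  finally show ?thesis by simp
qed

lemma prime_factors_prod_primes:
  fixes A :: "nat set"
  assumes "finite A" "\<And>p. p \<in> A \<Longrightarrow> prime p"
  shows "prime_factors (\<Prod>A) = A"
proof -
  have "prime_factors (\<Prod>A) = (\<Union>p\<in>A. prime_factors p)"
    using prime_factors_prod[of A "\<lambda>x. x"] assms(1) assms(2)[of 0] by auto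
  also have "\<dots> = A" using assms by (auto simp: prime_prime_factors)
  finally show ?thesis .
qed

lemma squarefree_prod_primes:
  fixes A :: "nat set"
  assumes "\<And>p. p \<in> A \<Longrightarrow> prime p"
  shows "squarefree (\<Prod>A)"
  by (rule squarefree_prod_coprime) (auto simp: assms primes_coprime squarefree_prime)

text \<open>The product of the primes up to \<open>n\<close> is itself admissible, with equality in
  the sum condition. Any other candidate is the product of its prime factors, to which
  \<open>prod_primes_le\<close> applies.\<close>

lemma h_sum_primes_le:
  fixes n :: nat
  shows "h (\<Sum>{p. prime p \<and> p \<le> n}) = \<Prod>{p. prime p \<and> p \<le> n}"
  unfolding h_def
proof (rule Max_eqI)
  show "finite {M. squarefree M \<and> ell M \<le> \<Sum>{p. prime p \<and> p \<le> n}}"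
    by (rule finite_h_set)
  show "M \<le> \<Prod>{p. prime p \<and> p \<le> n}"
    if "M \<in> {M. squarefree M \<and> ell M \<le> \<Sum>{p. prime p \<and> p \<le> n}}" for M
    using that prod_primes_le[of "prime_factors M" n]
    by (auto simp: ell_def prod_prime_factors_squarefree)
  show "\<Prod>{p. prime p \<and> p \<le> n} \<in> {M. squarefree M \<and> ell M \<le> \<Sum>{p. prime p \<and> p \<le> n}}"
  proof (intro CollectI conjI)
    show "squarefree (\<Prod>{p. prime p \<and> p \<le> n})"
      by (rule squarefree_prod_primes) simp
    have "prime_factors (\<Prod>{p. prime p \<and> p \<le> n}) = {p. prime p \<and> p \<le> n}"
      by (rule prime_factors_prod_primes) simp_all
    then show "ell (\<Prod>{p. prime p \<and> p \<le> n}) \<le> \<Sum>{p. prime p \<and> p \<le> n}"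
      unfolding ell_def by (simp only: order_refl)
  qed
qed

text \<open>Translates between indexed primes and primes below a bound, because the enumeration is
  strictly increasing and exhausts the primes. For \<open>j = 0\<close> it would fail: the index set
  is empty, but \<open>nth_prime 0 = 2\<close>.\<close>

lemma bij_betw_nth_prime:
  assumes "j > 0"
  shows "bij_betw nth_prime {1..j} {p. prime p \<and> p \<le> nth_prime j}"
proof -
  have mono: "enumerate {p::nat. prime p} m \<le> enumerate {p. prime p} n \<longleftrightarrow> m \<le> n" for m n
    using strict_mono_less_eq[OF strict_mono_enumerate[OF primes_infinite]] .
  show ?thesis
  proof (rule bij_betw_imageI)
    show "inj_on nth_prime {1..j}"
    proof (rule inj_onI)
      fix x y assume xy: "x \<in> {1..j}" "y \<in> {1..j}" "nth_prime x = nth_prime y"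
      then have "x - 1 = y - 1"
        using mono unfolding nth_prime_def by (metis order_antisym order_refl)
      \<comment> \<open>Truncated subtraction is cancelled here because both indices are at least
        1.\<close>
      then show "x = y" using xy by auto
    qed
    show "nth_prime ` {1..j} = {p. prime p \<and> p \<le> nth_prime j}"
    proof (intro equalityI subsetI)
      fix p assume "p \<in> nth_prime ` {1..j}"
      then show "p \<in> {p. prime p \<and> p \<le> nth_prime j}"
        using enumerate_in_set[OF primes_infinite] by (auto simp: nth_prime_def mono)
    next
      fix p assume p: "p \<in> {p. prime p \<and> p \<le> nth_prime j}"
      then obtain i where i: "p = enumerate {p. prime p} i"
        using enumerate_Ex[of "{p. prime p}" p] primes_infinite by auto
      then have "i \<le> j - 1" using p by (simp add: nth_prime_def mono)
      then have "Suc i \<in> {1..j}" using assms by auto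
      moreover have "p = nth_prime (Suc i)" by (simp add: nth_prime_def i)
      ultimately show "p \<in> nth_prime ` {1..j}" by blast
    qed
  qed
qed

theorem proposition3p1:
  fixes j :: nat
  assumes "j > 0"
  shows "h (\<Sum>i=1..j. nth_prime i) = (\<Prod>i=1..j. nth_prime i)"
  using h_sum_primes_le[of "nth_prime j"]
    sum.reindex_bij_betw[OF bij_betw_nth_prime[OF assms], of "\<lambda>x. x"]
    prod.reindex_bij_betw[OF bij_betw_nth_prime[OF assms], of "\<lambda>x. x"]
  by (simp only:)

end
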